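(* Let $0<q<p\le\infty$ and let $\alpha,\sigma,\omega\in[0,\infty]^{\mathbb{N}}$ be sequences satisfying $\alpha^p=\sigma^{p-q}\omega^q$ (or $\alpha=\sigma$ in the case $p=\infty$). For a sequence $v\in\mathbb{R}^{\mathbb{N}}$ with $\|\sigma v\|_{\ell^\infty}<\infty$ and $\|\omega v\|_{\ell^q}<\infty$, let $J_n$ be the set of indices corresponding to the $n$ largest elements of the sequence $\sigma|v|$. Then $$ \|v-P_{J_n}v\|_{\ell^p_\alpha}\le \big\|P_{J_{n+1}}\tfrac{\omega}{\sigma}\big\|_{\ell^q}^{-sq}\,\|v\|_{\ell^q_\omega},\qquad s:=\tfrac1q-\tfrac1p . $$ For $\alpha\equiv 1$ it holds that $\sigma=\omega^{-q/(p-q)}$ and the inequality simplifies to $$ \|v-P_{J_n}v\|_{\ell^p}\le\|P_{J_{n+1}}\omega\|_{\ell^{1/s}}^{-1}\,\|v\|_{\ell^q_\omega},\qquad s:=\tfrac1q-\tfrac1p . $$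
   Context: All operations on sequences (products, quotients, powers, absolute values) are element-wise. For $J\subseteq\mathbb{N}$, $P_J$ is the projection that keeps the entries with index in $J$ and sets all other entries to $0$. For $0<p\le\infty$ and a weight sequence $\omega\in[0,\infty]^{\mathbb{N}}$, $\|v\|_{\ell^p_\omega}:=\|\omega v\|_{\ell^p}$ and $\ell^p_\omega:=\{v\in\mathbb{R}^{\mathbb{N}}:\|v\|_{\ell^p_\omega}<\infty\}$.
   Formalization: For p=∞ the case where both ‖P_{J_{n+1}}ω/σ‖_{ℓ^q} and ‖v‖_{ℓ^q_ω} are 0 is excluded: the right side is then the undefined product 0^{-1}·0, and with ∞·0=0 the bound fails (α=σ=1, ω=0, v=e_1, n=0). *)

theory Defs
  imports "HOL-Analysis.Analysis"
begin

text \<open>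
  Weights are sequences in \<^typ>\<open>ennreal\<close>, i.e. in $[0,\infty]$, with the convention
  $0 \cdot \infty = 0$ of that type. Hence an infinite weight at an index where the sequence
  vanishes contributes nothing, and an infinite weight elsewhere makes the norm infinite.
  Quotients of weights follow \<^typ>\<open>ennreal\<close> as well: $a / 0 = \infty$ for $a \neq 0$, and
  $0 / 0 = \infty / \infty = 0$.
\<close>

text \<open>
  Real powers on $[0,\infty]$. The conventions at the end points are
  $0^0 = \infty^0 = 1$, $0^r = \infty$ and $\infty^r = 0$ for $r < 0$.
\<close>

definition epow :: "ennreal \<Rightarrow> real \<Rightarrow> ennreal" where
  "epow x r =
    (if r = 0 then 1
     else if x = 0 then (if r > 0 then 0 else \<infinity>)
     else if x = \<infinity> then (if r > 0 then \<infinity> else 0)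
     else ennreal (enn2real x powr r))"

text \<open>The $\ell^p$ (quasi-)norm of a nonnegative sequence, meant for $0 < p \le \infty$.\<close>

definition lp_norm :: "ereal \<Rightarrow> (nat \<Rightarrow> ennreal) \<Rightarrow> ennreal" where
  "lp_norm p x =
    (if p = \<infinity> then (SUP k. x k)
     else epow (\<Sum>k. epow (x k) (real_of_ereal p)) (1 / real_of_ereal p))"

definition weighted_norm :: "ereal \<Rightarrow> (nat \<Rightarrow> ennreal) \<Rightarrow> (nat \<Rightarrow> real) \<Rightarrow> ennreal" where
  "weighted_norm p w v = lp_norm p (\<lambda>k. w k * ennreal \<bar>v k\<bar>)"

definition proj :: "nat set \<Rightarrow> (nat \<Rightarrow> 'a::zero) \<Rightarrow> nat \<Rightarrow> 'a" where
  "proj J x = (\<lambda>k. if k \<in> J then x k else 0)"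

text \<open>
  \<open>J\<close> indexes \<open>n\<close> largest entries of \<open>x\<close>. Such a set need not be unique, because of ties,
  and need not exist, because the supremum of infinitely many entries need not be attained.
\<close>

definition n_largest :: "nat \<Rightarrow> (nat \<Rightarrow> ennreal) \<Rightarrow> nat set \<Rightarrow> bool" where
  "n_largest n x J \<longleftrightarrow> finite J \<and> card J = n \<and> (\<forall>i\<in>J. \<forall>j. j \<notin> J \<longrightarrow> x j \<le> x i)"

end

theory Submission
  imports Defs
begin

text \<open>
  Put \<open>x = \<sigma> |v|\<close> and let \<open>\<tau>\<close> be the supremum of \<open>x\<close> outside \<open>J\<^sub>n\<close>. The bound
  results from eliminating \<open>\<tau>\<close> between two estimates.

  The tail is controlled by \<open>\<tau>\<close>: for \<open>p < \<infinity>\<close> the hypothesis on the weights factorises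
  \<open>(\<alpha> |v|)\<^sup>p\<close> into \<open>x\<^sup>p\<^sup>-\<^sup>q (\<omega> |v|)\<^sup>q\<close>, and the first factor is at most \<open>\<tau>\<^sup>p\<^sup>-\<^sup>q\<close> outside
  \<open>J\<^sub>n\<close>. With \<open>V = \<Sum> (\<omega> |v|)\<^sup>q\<close> this gives the bound \<open>\<tau>\<^sup>q\<^sup>s V\<^sup>1\<^sup>/\<^sup>p\<close> for the tail
  (\<open>tail_weighted_norm_le\<close>). It remains valid for \<open>p = \<infinity>\<close>, where \<open>q s = 1\<close> and \<open>V\<^sup>0 = 1\<close>.

  In turn \<open>\<tau>\<close> is controlled by \<open>V\<close>: every entry of \<open>x\<close> indexed by \<open>J\<^sub>n\<^sub>+\<^sub>1\<close> is at least \<open>\<tau>\<close>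
  (\<open>n_largest_tail_le\<close>), so there \<open>\<tau> \<omega> / \<sigma> \<le> \<omega> |v|\<close>. Raising this to the power \<open>q\<close> and
  summing gives \<open>\<tau>\<^sup>q R \<le> V\<close> for \<open>R = \<Sum> (\<omega> / \<sigma>)\<^sup>q\<close>, the sum running over \<open>J\<^sub>n\<^sub>+\<^sub>1\<close>.

  Since \<open>1 / q = s + 1 / p\<close>, eliminating \<open>\<tau>\<close> leaves \<open>R\<^sup>-\<^sup>s V\<^sup>s V\<^sup>1\<^sup>/\<^sup>p = R\<^sup>-\<^sup>s V\<^sup>1\<^sup>/\<^sup>q\<close>. This
  division by \<open>R\<^sup>s\<close> is the only delicate step in \<open>[0, \<infinity>]\<close> (\<open>epow_eliminate\<close>): if \<open>\<tau> > 0\<close> then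
  \<open>R\<close> is automatically finite, and if \<open>R = 0\<close> the right-hand side is infinite unless \<open>V = 0\<close>.
  In the remaining case \<open>R = V = 0\<close> the tail bound \<open>\<tau>\<^sup>q\<^sup>s V\<^sup>1\<^sup>/\<^sup>p\<close> is \<open>0\<close> for \<open>p < \<infinity>\<close>, whereas for
  \<open>p = \<infinity>\<close> this is the excluded indeterminate product.

  For \<open>\<alpha> = 1\<close> and \<open>p < \<infinity>\<close> the relation \<open>1 = \<sigma>\<^sup>p\<^sup>-\<^sup>q \<omega>\<^sup>q\<close> forces both weights to be positive
  and finite, hence \<open>\<sigma> = \<omega>\<^sup>-\<^sup>q\<^sup>/\<^sup>(\<^sup>p\<^sup>-\<^sup>q\<^sup>)\<close> and \<open>(\<omega> / \<sigma>)\<^sup>q = \<omega>\<^sup>1\<^sup>/\<^sup>s\<close>; the second inequality is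
  the first one rewritten.
\<close>

section \<open>Powers on the extended half-line\<close>

lemma epow_zero_exponent [simp]: "epow x 0 = 1"
  by (simp add: epow_def)

lemma epow_zero [simp]: "r > 0 \<Longrightarrow> epow 0 r = 0"
  by (simp add: epow_def)

lemma epow_one_exponent [simp]: "epow x 1 = x"
  by (auto simp: epow_def less_top)

lemma epow_one_base [simp]: "epow 1 r = 1"
  by (auto simp: epow_def)

lemma epow_ennreal: "a > 0 \<Longrightarrow> epow (ennreal a) r = ennreal (a powr r)"
  by (auto simp: epow_def)

lemma ennreal_zero_top_cases [case_names zero top pos]:
  obtains "x = 0" | "x = (\<infinity>::ennreal)" | a where "a > 0" "x = ennreal a"
  by (cases x rule: ennreal_cases) (metis ennreal_0 infinity_ennreal_def less_le)+

lemma epow_mult: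
  assumes "r \<ge> 0"
  shows "epow (x * y) r = epow x r * epow y r"
proof (cases "r = 0")
  case False
  with assms have "r > 0" by simp
  then show ?thesis
    by (cases x rule: ennreal_zero_top_cases; cases y rule: ennreal_zero_top_cases)
       (auto simp: epow_ennreal epow_def powr_mult ennreal_mult[symmetric] ennreal_mult_top
          ennreal_top_mult)
qed simp

lemma epow_add:
  assumes "a \<ge> 0" "b \<ge> 0"
  shows "epow x (a + b) = epow x a * epow x b"
  using assms
  by (cases x rule: ennreal_zero_top_cases)
     (auto simp: epow_ennreal epow_def powr_add ennreal_mult)

lemma epow_epow: "epow (epow x a) b = epow x (a * b)"
  by (cases x rule: ennreal_zero_top_cases)
     (auto simp: epow_ennreal powr_powr epow_def mult_less_0_iff zero_less_mult_iff)

lemma epow_minus: "epow x (- r) = inverse (epow x r)"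
  by (cases x rule: ennreal_zero_top_cases)
     (auto simp: epow_ennreal epow_def powr_minus inverse_ennreal)

lemma epow_eq_0_iff: "r > 0 \<Longrightarrow> epow x r = 0 \<longleftrightarrow> x = 0"
  by (cases x rule: ennreal_zero_top_cases) (auto simp: epow_ennreal epow_def)

lemma epow_eq_top_iff: "r > 0 \<Longrightarrow> epow x r = \<infinity> \<longleftrightarrow> x = \<infinity>"
  by (cases x rule: ennreal_zero_top_cases) (auto simp: epow_ennreal epow_def)

lemma epow_mono:
  assumes "r \<ge> 0" "x \<le> y"
  shows "epow x r \<le> epow y r"
  using assms
  by (cases x rule: ennreal_zero_top_cases; cases y rule: ennreal_zero_top_cases)
     (auto simp: epow_ennreal epow_def top_unique powr_mono2)

lemma lp_norm_ereal: "lp_norm (ereal q) x = epow (\<Sum>k. epow (x k) q) (1 / q)"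
  by (simp add: lp_norm_def)

text \<open>
  Dividing by \<open>R\<^sup>s\<close> is legitimate when \<open>0 < R < \<infinity>\<close>. For \<open>R = \<infinity>\<close> the inequality \<open>t R \<le> V < \<infinity>\<close>
  forces \<open>t = 0\<close>. For \<open>R = 0\<close> the right-hand side is \<open>\<infinity> V\<^sup>s\<^sup>+\<^sup>r\<close>; when \<open>V = 0\<close>
  this product is \<open>0\<close>, and it takes \<open>r > 0\<close> for the factor \<open>V\<^sup>r\<close> to make the left-hand side
  vanish too.
\<close>

lemma epow_eliminate:
  assumes s: "s > 0" and r: "r \<ge> 0" and le: "t * R \<le> V" and V: "V < \<infinity>"
    and determinate: "R = 0 \<Longrightarrow> V = 0 \<Longrightarrow> r > 0"
  shows "epow t s * epow V r \<le> epow R (- s) * epow V (s + r)"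
proof (cases "t = 0")
  case True
  then show ?thesis using s by simp
next
  case t: False
  have Vsr: "epow V (s + r) = epow V s * epow V r"
    using s r by (simp add: epow_add)
  have R_fin: "R \<noteq> \<infinity>"
    using t le V by (auto simp: ennreal_mult_top top_unique)
  show ?thesis
  proof (cases "R = 0")
    case R: True
    show ?thesis
    proof (cases "V = 0")
      case True
      with R determinate show ?thesis by simp
    next
      case False
      then have "epow V (s + r) \<noteq> 0" using s r by (simp add: epow_eq_0_iff)
      then show ?thesis using R s by (simp add: epow_def ennreal_top_mult)
    qed
  next
    case R: False
    have Rs: "epow R s \<noteq> 0" "epow R s \<noteq> \<infinity>"
      using R R_fin s by (simp_all add: epow_eq_0_iff epow_eq_top_iff del: infinity_ennreal_def)
    have "epow t s * epow R s \<le> epow V s"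
      using epow_mono[OF _ le, of s] s by (simp add: epow_mult)
    then have "epow t s * epow R s / epow R s \<le> epow V s / epow R s"
      by (rule divide_right_mono_ennreal)
    then have "epow t s \<le> inverse (epow R s) * epow V s"
      using Rs by (simp add: mult_divide_eq_ennreal) (simp add: divide_ennreal_def mult.commute)
    then have "epow t s * epow V r \<le> inverse (epow R s) * epow V s * epow V r"
      by (rule mult_right_mono) simp
    then show ?thesis by (simp add: epow_minus Vsr mult.assoc)
  qed
qed

section \<open>The tail after the largest entries\<close>

text \<open>
  The two index sets need not be nested because of ties. If \<open>i\<close> and \<open>k\<close> both lie in \<open>I\<close> but not
  in \<open>J\<close>, counting yields a third index in \<open>J - I\<close>, whose entry lies between those of \<open>k\<close> and \<open>i\<close>.
\<close>

lemma n_largest_tail_le: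
  assumes J: "n_largest n x J" and I: "n_largest (Suc n) x I"
    and i: "i \<in> I" and k: "k \<notin> J"
  shows "x k \<le> x i"
proof (cases "k \<in> I \<and> i \<notin> J \<and> i \<noteq> k")
  case False
  then show ?thesis using assms by (auto simp: n_largest_def)
next
  case True
  have fin: "finite I" "finite J" and card: "card I = Suc n" "card J = n"
    using I J by (auto simp: n_largest_def)
  have "\<not> J \<subseteq> I"
  proof
    assume "J \<subseteq> I"
    then have "insert i (insert k J) \<subseteq> I" using True i by auto
    then have "card (insert i (insert k J)) \<le> card I" using fin by (intro card_mono)
    then show False using True k fin card by simp
  qed
  then obtain j where "j \<in> J" "j \<notin> I" by auto
  then have "x k \<le> x j" "x j \<le> x i"
    using I J i k by (auto simp: n_largest_def)
  then show ?thesis by (rule order_trans)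
qed

text \<open>
  The exponents are written through \<open>s = 1 / q - 1 / p\<close> because \<open>(p - q) / p = q s\<close>, which turns
  the case \<open>p = \<infinity>\<close> into an instance of the same formula.
\<close>

lemma tail_weighted_norm_le:
  fixes p :: ereal and q s :: real
    and \<alpha> \<sigma> \<omega> :: "nat \<Rightarrow> ennreal" and v :: "nat \<Rightarrow> real"
  assumes q_pos: "0 < q" and q_less_p: "ereal q < p"
    and weights: "if p = \<infinity> then \<alpha> = \<sigma>
      else (\<forall>k. epow (\<alpha> k) (real_of_ereal p) = epow (\<sigma> k) (real_of_ereal p - q) * epow (\<omega> k) q)"
    and s_def: "s = 1 / q - real_of_ereal (1 / p)"
    and tail: "\<And>k. k \<notin> J \<Longrightarrow> \<sigma> k * ennreal \<bar>v k\<bar> \<le> \<tau>"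
  shows "weighted_norm p \<alpha> (\<lambda>k. v k - proj J v k)
    \<le> epow \<tau> (q * s) * epow (\<Sum>k. epow (\<omega> k * ennreal \<bar>v k\<bar>) q) (real_of_ereal (1 / p))"
proof (cases p)
  case PInf
  have "\<sigma> k * ennreal \<bar>v k - proj J v k\<bar> \<le> \<tau>" for k
    using tail[of k] by (auto simp: proj_def)
  then show ?thesis
    using PInf weights s_def q_pos by (simp add: weighted_norm_def lp_norm_def SUP_le_iff)
next
  case (real p')
  then have p': "q < p'" "0 < p'" using q_less_p q_pos by auto
  let ?V = "\<Sum>k. epow (\<omega> k * ennreal \<bar>v k\<bar>) q"
  have term_le: "epow (\<alpha> k * ennreal \<bar>v k - proj J v k\<bar>) p'
      \<le> epow \<tau> (p' - q) * epow (\<omega> k * ennreal \<bar>v k\<bar>) q" for k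
  proof (cases "k \<in> J")
    case True
    then show ?thesis using p' by (simp add: proj_def)
  next
    case False
    have "epow (\<alpha> k * ennreal \<bar>v k - proj J v k\<bar>) p' = epow (\<alpha> k) p' * epow (ennreal \<bar>v k\<bar>) p'"
      using False p' by (simp add: proj_def epow_mult)
    also have "epow (ennreal \<bar>v k\<bar>) p' = epow (ennreal \<bar>v k\<bar>) (p' - q) * epow (ennreal \<bar>v k\<bar>) q"
      using epow_add[of "p' - q" q] p' q_pos by simp
    also have "epow (\<alpha> k) p' = epow (\<sigma> k) (p' - q) * epow (\<omega> k) q"
      using weights real by simp
    also have "epow (\<sigma> k) (p' - q) * epow (\<omega> k) q
        * (epow (ennreal \<bar>v k\<bar>) (p' - q) * epow (ennreal \<bar>v k\<bar>) q)
      = epow (\<sigma> k * ennreal \<bar>v k\<bar>) (p' - q) * epow (\<omega> k * ennreal \<bar>v k\<bar>) q"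
      using p' q_pos by (simp add: epow_mult ac_simps)
    also have "\<dots> \<le> epow \<tau> (p' - q) * epow (\<omega> k * ennreal \<bar>v k\<bar>) q"
      using tail[OF False] p' by (intro mult_right_mono epow_mono) auto
    finally show ?thesis .
  qed
  have "(\<Sum>k. epow (\<alpha> k * ennreal \<bar>v k - proj J v k\<bar>) p') \<le> epow \<tau> (p' - q) * ?V"
    unfolding ennreal_suminf_cmult[symmetric] by (intro suminf_le term_le) auto
  then have "weighted_norm p \<alpha> (\<lambda>k. v k - proj J v k) \<le> epow (epow \<tau> (p' - q) * ?V) (1 / p')"
    using real p' by (simp add: weighted_norm_def lp_norm_ereal epow_mono)
  also have "\<dots> = epow \<tau> ((p' - q) * (1 / p')) * epow ?V (1 / p')"
    using p' by (subst epow_mult) (simp_all add: epow_epow)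
  also have "(p' - q) * (1 / p') = q * s"
    using real p' q_pos s_def by (simp add: field_simps one_ereal_def)
  finally show ?thesis using real p' by (simp add: one_ereal_def)
qed (use q_less_p in auto)

section \<open>The constant weight\<close>

text \<open>
  With \<open>0 \<infinity> = 0\<close> no product involving \<open>0\<close> or \<open>\<infinity>\<close> is \<open>1\<close>, so the relation
  can be solved for \<open>\<sigma>\<close> among the positive reals.
\<close>

lemma epow_mult_epow_eq_1D:
  assumes ab: "a > 0" "b > 0" and eq: "epow x a * epow y b = 1"
  shows "x = epow y (- (b / a))"
    and "y / x = epow y (1 + b / a)"
proof -
  have "0 < x" "x < \<infinity>" "0 < y" "y < \<infinity>"
    using ab eq
    by (cases x rule: ennreal_zero_top_cases; cases y rule: ennreal_zero_top_cases;
        auto simp: epow_ennreal epow_def ennreal_mult_top ennreal_top_mult)+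
  then obtain c d where cd: "c > 0" "x = ennreal c" "d > 0" "y = ennreal d"
    by (metis ennreal_zero_top_cases less_irrefl)
  have "c powr a * d powr b = 1"
    using eq cd by (simp add: epow_ennreal ennreal_mult[symmetric] ennreal_eq_1)
  then have "c powr a = d powr (- b)"
    using cd by (simp add: powr_minus field_simps)
  then have "(c powr a) powr (1 / a) = (d powr (- b)) powr (1 / a)" by simp
  then have c: "c = d powr (- (b / a))"
    using ab cd by (simp add: powr_powr)
  show "x = epow y (- (b / a))" using c cd by (simp add: epow_ennreal)
  have "d / c = d powr (1 + b / a)"
    using c cd by (simp add: powr_add powr_minus field_simps)
  then show "y / x = epow y (1 + b / a)"
    using cd by (simp add: epow_ennreal divide_ennreal)
qed

section \<open>The approximation estimate\<close>

theorem lemma6: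
  fixes p :: ereal and q s :: real
    and \<alpha> \<sigma> \<omega> :: "nat \<Rightarrow> ennreal"
    and v :: "nat \<Rightarrow> real"
    and J :: "nat \<Rightarrow> nat set" and n :: nat
  assumes q_pos: "0 < q" and q_less_p: "ereal q < p"
    and weights: "if p = \<infinity> then \<alpha> = \<sigma>
      else (\<forall>k. epow (\<alpha> k) (real_of_ereal p) = epow (\<sigma> k) (real_of_ereal p - q) * epow (\<omega> k) q)"
    and sigma_v: "weighted_norm \<infinity> \<sigma> v < \<infinity>"
    and omega_v: "weighted_norm (ereal q) \<omega> v < \<infinity>"
    and J_n: "n_largest n (\<lambda>k. \<sigma> k * ennreal \<bar>v k\<bar>) (J n)"
    and J_Suc_n: "n_largest (Suc n) (\<lambda>k. \<sigma> k * ennreal \<bar>v k\<bar>) (J (Suc n))"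
    (* For p = \<infinity> the right-hand side may be the indeterminate product of 0 to a negative power
       with 0, for which the convention \<infinity> * 0 = 0 would give a false bound
       (e.g. \<alpha> = \<sigma> = 1, \<omega> = 0, v \<noteq> 0, n = 0). *)
    and determinate: "\<not> (p = \<infinity>
      \<and> lp_norm (ereal q) (proj (J (Suc n)) (\<lambda>k. \<omega> k / \<sigma> k)) = 0
      \<and> weighted_norm (ereal q) \<omega> v = 0)"
    and s_def: "s = 1 / q - real_of_ereal (1 / p)"
  shows "weighted_norm p \<alpha> (\<lambda>k. v k - proj (J n) v k)
        \<le> epow (lp_norm (ereal q) (proj (J (Suc n)) (\<lambda>k. \<omega> k / \<sigma> k))) (- (s * q))
          * weighted_norm (ereal q) \<omega> v
    \<and> ((\<forall>k. \<alpha> k = 1) \<longrightarrow>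
        (\<forall>k. \<sigma> k = epow (\<omega> k) (- real_of_ereal (ereal q / (p - ereal q))))
        \<and> lp_norm p (\<lambda>k. ennreal \<bar>v k - proj (J n) v k\<bar>)
          \<le> epow (lp_norm (ereal (1 / s)) (proj (J (Suc n)) \<omega>)) (- 1)
            * weighted_norm (ereal q) \<omega> v)"
proof -
  define r where "r = real_of_ereal (1 / p)"
  have p_cases: "p = \<infinity> \<and> r = 0 \<or> (\<exists>p'. p = ereal p' \<and> q < p' \<and> r = 1 / p')"
    using q_less_p q_pos by (cases p) (auto simp: r_def one_ereal_def)
  then have r: "r \<ge> 0" and "r < 1 / q"
    using q_pos by (auto simp: divide_strict_left_mono)
  then have s_pos: "s > 0" using s_def r_def by simp
  have sr: "1 / q = s + r" using s_def r_def by simp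
  define V where "V = (\<Sum>k. epow (\<omega> k * ennreal \<bar>v k\<bar>) q)"
  define R where "R = (\<Sum>k. epow (proj (J (Suc n)) (\<lambda>k. \<omega> k / \<sigma> k) k) q)"
  define \<tau> where "\<tau> = (SUP k\<in>- J n. \<sigma> k * ennreal \<bar>v k\<bar>)"
  have norm_V: "weighted_norm (ereal q) \<omega> v = epow V (s + r)"
    by (simp add: weighted_norm_def lp_norm_ereal V_def sr)
  have norm_R: "lp_norm (ereal q) (proj (J (Suc n)) (\<lambda>k. \<omega> k / \<sigma> k)) = epow R (s + r)"
    by (simp add: lp_norm_ereal R_def sr)
  have RHS: "epow (lp_norm (ereal q) (proj (J (Suc n)) (\<lambda>k. \<omega> k / \<sigma> k))) (- (s * q)) = epow R (- s)"
    using q_pos by (simp add: lp_norm_ereal R_def epow_epow)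
  have V_fin: "V < \<infinity>"
    using omega_v s_pos r epow_eq_top_iff[of "s + r" V] unfolding norm_V
    by (auto simp: less_top)

  have "\<tau> * proj (J (Suc n)) (\<lambda>k. \<omega> k / \<sigma> k) k \<le> \<omega> k * ennreal \<bar>v k\<bar>" for k
  proof (cases "k \<in> J (Suc n)")
    case True
    have cancel: "\<sigma> k * (\<omega> k / \<sigma> k) \<le> \<omega> k"
      by (cases "\<omega> k" rule: ennreal_zero_top_cases; cases "\<sigma> k" rule: ennreal_zero_top_cases)
         (auto simp: divide_ennreal ennreal_mult[symmetric] ennreal_top_divide)
    have "\<tau> \<le> \<sigma> k * ennreal \<bar>v k\<bar>"
      unfolding \<tau>_def using n_largest_tail_le[OF J_n J_Suc_n True] by (intro SUP_least) auto
    then have "\<tau> * (\<omega> k / \<sigma> k) \<le> \<sigma> k * ennreal \<bar>v k\<bar> * (\<omega> k / \<sigma> k)"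
      by (rule mult_right_mono) simp
    also have "\<dots> = \<sigma> k * (\<omega> k / \<sigma> k) * ennreal \<bar>v k\<bar>" by (simp only: ac_simps)
    also have "\<dots> \<le> \<omega> k * ennreal \<bar>v k\<bar>" using cancel by (rule mult_right_mono) simp
    finally show ?thesis using True by (simp add: proj_def)
  qed (simp add: proj_def)
  then have "epow \<tau> q * epow (proj (J (Suc n)) (\<lambda>k. \<omega> k / \<sigma> k) k) q
      \<le> epow (\<omega> k * ennreal \<bar>v k\<bar>) q" for k
    using q_pos by (subst epow_mult[symmetric]) (auto intro: epow_mono)
  then have \<tau>_R: "epow \<tau> q * R \<le> V"
    unfolding R_def V_def ennreal_suminf_cmult[symmetric] by (intro suminf_le) auto

  have "weighted_norm p \<alpha> (\<lambda>k. v k - proj (J n) v k) \<le> epow \<tau> (q * s) * epow V r"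
    unfolding V_def r_def
    by (rule tail_weighted_norm_le[OF q_pos q_less_p weights s_def])
       (auto simp: \<tau>_def intro: SUP_upper)
  also have "\<dots> = epow (epow \<tau> q) s * epow V r" by (simp add: epow_epow)
  also have "\<dots> \<le> epow R (- s) * epow V (s + r)"
  proof (rule epow_eliminate[OF s_pos r \<tau>_R V_fin])
    assume "R = 0" "V = 0"
    then have "p \<noteq> \<infinity>"
      using determinate s_pos r unfolding norm_R norm_V by auto
    then show "r > 0" using p_cases q_pos by auto
  qed
  finally have main: "weighted_norm p \<alpha> (\<lambda>k. v k - proj (J n) v k)
    \<le> epow R (- s) * epow V (s + r)" .

  have unit: "(\<forall>k. \<sigma> k = epow (\<omega> k) (- real_of_ereal (ereal q / (p - ereal q))))
      \<and> (\<forall>k. epow (\<omega> k / \<sigma> k) q = epow (\<omega> k) (1 / s))" if \<alpha>: "\<forall>k. \<alpha> k = 1"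
    using p_cases
  proof (elim disjE exE conjE)
    assume "p = \<infinity>" "r = 0"
    then show ?thesis
      using weights \<alpha> s_def r_def mult_divide_eq_ennreal[of 1] by simp
  next
    fix p' assume p': "p = ereal p'" "q < p'" "r = 1 / p'"
    have eq: "epow (\<sigma> k) (p' - q) * epow (\<omega> k) q = 1" for k
      using weights \<alpha> p' by simp
    have "s = (p' - q) / (p' * q)"
      using s_def p' q_pos unfolding r_def[symmetric] by (simp add: field_simps)
    then have "1 / s = p' * q / (p' - q)" by simp
    also have "\<dots> = (1 + q / (p' - q)) * q"
      using p' by (simp add: field_simps)
    finally have "(1 + q / (p' - q)) * q = 1 / s" ..
    then show ?thesis
      using epow_mult_epow_eq_1D[OF _ q_pos eq] p' by (simp add: epow_epow)
  qed
  have R_unit: "epow R (- s) = epow (lp_norm (ereal (1 / s)) (proj (J (Suc n)) \<omega>)) (- 1)"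
    if "\<forall>k. \<alpha> k = 1"
  proof -
    have "epow (proj (J (Suc n)) (\<lambda>k. \<omega> k / \<sigma> k) k) q = epow (proj (J (Suc n)) \<omega> k) (1 / s)" for k
      using conjunct2[OF unit[OF that]] q_pos s_pos by (simp add: proj_def)
    then show ?thesis by (simp add: R_def lp_norm_ereal epow_epow)
  qed
  have norm_unit: "lp_norm p (\<lambda>k. ennreal \<bar>v k - proj (J n) v k\<bar>)
      = weighted_norm p \<alpha> (\<lambda>k. v k - proj (J n) v k)" if "\<forall>k. \<alpha> k = 1"
    using that by (simp add: weighted_norm_def)
  show ?thesis
    using main unit R_unit norm_unit unfolding RHS norm_V by auto
qed

end
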